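(* Let $\mathcal{G} = \{G_1, \ldots, G_p\}$ and $\mathcal{H} = \{H_1, \ldots, H_q\}$ be families of connected graphs such that the graphs in $\mathcal{G}$ are mutually cospectral, the graphs in $\mathcal{H}$ are mutually cospectral, and the common spectrum of the graphs in $\mathcal{G}$ differs from the common spectrum of the graphs in $\mathcal{H}$. Suppose at least one of the following conditions holds: (1) every graph in $\mathcal{G} \cup \mathcal{H}$ is Cartesian prime; (2) $\gcd(|V(G)|, |V(H)|) = 1$ for all $G \in \mathcal{G}$ and $H \in \mathcal{H}$; (3) there is no Cartesian prime graph $P$ that is a Cartesian factor of both some $G \in \mathcal{G}$ and some $H \in \mathcal{H}$. Then the graphs $F_{ij} = G_i \square H_j$, $1 \le i \le p$, $1 \le j \le q$, are connected, all have the same spectrum, and are pairwise non-isomorphic; that is, $\mathcal{F} = \{F_{ij}\}$ is a connected mutually cospectral family of size $pq$.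
   Context: All graphs are finite and simple. Spectra are taken with respect to a fixed choice of matrix representation: either the adjacency matrix or the Laplacian matrix (the same choice throughout). Two graphs are cospectral if they have the same spectrum and are non-isomorphic; a family of graphs is mutually cospectral if its members all have the same spectrum and are pairwise non-isomorphic. $G \square H$ denotes the Cartesian product. A graph is Cartesian prime if it is nontrivial (at least two vertices) and is not isomorphic to a Cartesian product of two nontrivial graphs. A Cartesian factor of $G$ is a graph $G_1$ with $G \cong G_1 \square G_2$ for some graph $G_2$. Connected graphs have a unique (up to isomorphism and order) factorization into Cartesian prime graphs. *)

theory Defs
  imports "HOL-Computational_Algebra.Computational_Algebra" "HOL-Combinatorics.Permutations"
begin

datatype 'a sgraph = Graph (verts: "'a set") (edges: "'a set set")

definition wf_graph :: "'a sgraph \<Rightarrow> bool" where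
  "wf_graph G \<longleftrightarrow> finite (verts G) \<and>
     (\<forall>e\<in>edges G. \<exists>u v. e = {u, v} \<and> u \<noteq> v \<and> u \<in> verts G \<and> v \<in> verts G)"

definition adj :: "'a sgraph \<Rightarrow> 'a \<Rightarrow> 'a \<Rightarrow> bool" where
  "adj G u v \<longleftrightarrow> {u, v} \<in> edges G"

definition connected_graph :: "'a sgraph \<Rightarrow> bool" where
  "connected_graph G \<longleftrightarrow> verts G \<noteq> {} \<and>
     (\<forall>u\<in>verts G. \<forall>v\<in>verts G. (adj G)\<^sup>*\<^sup>* u v)"

definition graph_iso :: "'a sgraph \<Rightarrow> 'b sgraph \<Rightarrow> bool" where
  "graph_iso G H \<longleftrightarrow> (\<exists>f. bij_betw f (verts G) (verts H) \<and>
     (\<forall>u\<in>verts G. \<forall>v\<in>verts G. adj G u v \<longleftrightarrow> adj H (f u) (f v)))"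

definition cart_prod :: "'a sgraph \<Rightarrow> 'b sgraph \<Rightarrow> ('a \<times> 'b) sgraph" (infixr "\<box>" 80) where
  "G \<box> H = Graph (verts G \<times> verts H)
     ({{(a, b), (a', b)} | a a' b. {a, a'} \<in> edges G \<and> b \<in> verts H}
           \<union> {{(a, b), (a, b')} | a b b'. a \<in> verts G \<and> {b, b'} \<in> edges H})"

text \<open>Cartesian prime: nontrivial and not isomorphic to a product of two nontrivial graphs.
  Factors of a graph on type 'a have fewer vertices, so they can be taken on type 'a as well.\<close>
definition cart_prime :: "'a sgraph \<Rightarrow> bool" where
  "cart_prime G \<longleftrightarrow> card (verts G) \<ge> 2 \<and>
     \<not> (\<exists>(G1 :: 'a sgraph) (G2 :: 'a sgraph). wf_graph G1 \<and> wf_graph G2 \<and>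
          card (verts G1) \<ge> 2 \<and> card (verts G2) \<ge> 2 \<and> graph_iso G (G1 \<box> G2))"

definition cart_factor :: "'a sgraph \<Rightarrow> 'a sgraph \<Rightarrow> bool" where
  "cart_factor G1 G \<longleftrightarrow> (\<exists>G2 :: 'a sgraph. wf_graph G2 \<and> graph_iso G (G1 \<box> G2))"

datatype mat_kind = Adjacency | Laplacian

definition adj_matrix :: "'a sgraph \<Rightarrow> 'a \<Rightarrow> 'a \<Rightarrow> complex" where
  "adj_matrix G u v = (if adj G u v then 1 else 0)"

definition degree :: "'a sgraph \<Rightarrow> 'a \<Rightarrow> nat" where
  "degree G v = card {u \<in> verts G. adj G v u}"

definition lap_matrix :: "'a sgraph \<Rightarrow> 'a \<Rightarrow> 'a \<Rightarrow> complex" where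
  "lap_matrix G u v = (if u = v then of_nat (degree G v) else - adj_matrix G u v)"

definition graph_matrix :: "mat_kind \<Rightarrow> 'a sgraph \<Rightarrow> 'a \<Rightarrow> 'a \<Rightarrow> complex" where
  "graph_matrix k G = (case k of Adjacency \<Rightarrow> adj_matrix G | Laplacian \<Rightarrow> lap_matrix G)"

text \<open>Characteristic polynomial det(xI - M) of a matrix indexed by a finite set S (Leibniz formula).\<close>
definition charpoly_on :: "'a set \<Rightarrow> ('a \<Rightarrow> 'a \<Rightarrow> complex) \<Rightarrow> complex poly" where
  "charpoly_on S M = (\<Sum>p\<in>{p. p permutes S}. of_int (sign p) *
      (\<Prod>v\<in>S. (if p v = v then [:0, 1:] else 0) - [:M v (p v):]))"

definition spectrum :: "mat_kind \<Rightarrow> 'a sgraph \<Rightarrow> complex multiset" where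
  "spectrum k G = proots (charpoly_on (verts G) (graph_matrix k G))"

end

theory Submission
  imports "Jordan_Normal_Form.Schur_Decomposition" Defs
begin

text \<open>
  Distances in a Cartesian product of connected graphs add up coordinatewise. Hence layers are
  geodesically convex, and a geodesically convex vertex set is a box, because \<open>(a, b')\<close> lies on a
  geodesic from \<open>(a, b)\<close> to \<open>(a', b')\<close>. So an isomorphism from \<open>G \<box> H\<close> to \<open>G' \<box> H'\<close> maps layers to
  boxes, which yields graphs with \<open>G \<cong> A \<box> B\<close>, \<open>H \<cong> C \<box> D\<close>, \<open>G' \<cong> A \<box> C\<close> and \<open>H' \<cong> B \<box> D\<close>. Each of the
  three conditions forces \<open>B\<close> and \<open>C\<close> to be trivial; for prime graphs the only alternative is
  \<open>G \<cong> H'\<close>, which the spectra exclude.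

  The matrix of \<open>G \<box> H\<close> is the Kronecker sum of the matrices of \<open>G\<close> and \<open>H\<close>. Triangularizing both
  summands shows that its eigenvalues are the sums of an eigenvalue of \<open>G\<close> and one of \<open>H\<close>.
\<close>

section \<open>Isomorphisms and Cartesian products\<close>

lemma wf_adjD:
  assumes "wf_graph G" "adj G u v"
  shows "u \<in> verts G" "v \<in> verts G" "u \<noteq> v"
  using assms by (auto simp: wf_graph_def adj_def doubleton_eq_iff dest!: bspec)

lemma verts_cart_prod [simp]: "verts (G \<box> H) = verts G \<times> verts H"
  by (simp add: cart_prod_def)

lemma adj_cart_prod:
  "adj (G \<box> H) (a, b) (c, d) \<longleftrightarrow>
     (adj G a c \<and> b = d \<and> b \<in> verts H) \<or> (a = c \<and> a \<in> verts G \<and> adj H b d)"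
proof
  assume "adj (G \<box> H) (a, b) (c, d)"
  then show "(adj G a c \<and> b = d \<and> b \<in> verts H) \<or> (a = c \<and> a \<in> verts G \<and> adj H b d)"
    unfolding adj_def cart_prod_def by (auto simp: doubleton_eq_iff insert_commute)
next
  assume "(adj G a c \<and> b = d \<and> b \<in> verts H) \<or> (a = c \<and> a \<in> verts G \<and> adj H b d)"
  then show "adj (G \<box> H) (a, b) (c, d)"
    unfolding adj_def cart_prod_def sgraph.sel by blast
qed

lemma wf_cart_prod:
  assumes "wf_graph G" "wf_graph H"
  shows "wf_graph (G \<box> H)"
  unfolding wf_graph_def
proof (intro conjI ballI)
  show "finite (verts (G \<box> H))"
    using assms by (simp add: wf_graph_def)
  fix e assume "e \<in> edges (G \<box> H)"
  then consider a a' b where "e = {(a, b), (a', b)}" "adj G a a'" "b \<in> verts H"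
    | a b b' where "e = {(a, b), (a, b')}" "a \<in> verts G" "adj H b b'"
    by (auto simp: cart_prod_def adj_def)
  then show "\<exists>u v. e = {u, v} \<and> u \<noteq> v \<and> u \<in> verts (G \<box> H) \<and> v \<in> verts (G \<box> H)"
  proof cases
    case 1
    then show ?thesis
      using wf_adjD[OF assms(1) 1(2)] by (intro exI[of _ "(a, b)"] exI[of _ "(a', b)"]) auto
  next
    case 2
    then show ?thesis
      using wf_adjD[OF assms(2) 2(3)] by (intro exI[of _ "(a, b)"] exI[of _ "(a, b')"]) auto
  qed
qed

text \<open>Exposes the witness behind the existential in \<open>graph_iso\<close>: the refinement
  argument follows single vertices through one fixed map and its inverse.\<close>

definition iso_map :: "('a \<Rightarrow> 'b) \<Rightarrow> 'a sgraph \<Rightarrow> 'b sgraph \<Rightarrow> bool" where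
  "iso_map f G H \<longleftrightarrow> bij_betw f (verts G) (verts H) \<and>
     (\<forall>u\<in>verts G. \<forall>v\<in>verts G. adj G u v \<longleftrightarrow> adj H (f u) (f v))"

lemma graph_iso_iff_iso_map: "graph_iso G H \<longleftrightarrow> (\<exists>f. iso_map f G H)"
  by (simp add: graph_iso_def iso_map_def)

lemma iso_map_in: "iso_map f G H \<Longrightarrow> u \<in> verts G \<Longrightarrow> f u \<in> verts H"
  by (auto simp: iso_map_def bij_betw_def)

lemma iso_map_adj:
  "iso_map f G H \<Longrightarrow> u \<in> verts G \<Longrightarrow> v \<in> verts G \<Longrightarrow> adj H (f u) (f v) \<longleftrightarrow> adj G u v"
  by (simp add: iso_map_def)

lemma iso_map_comp:
  assumes "iso_map f G H" "iso_map g H K"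
  shows "iso_map (g \<circ> f) G K"
  using assms bij_betw_trans[of f "verts G" "verts H" g "verts K"] iso_map_in[OF assms(1)]
  by (simp add: iso_map_def)

text \<open>Since \<open>f\<close> is onto \<open>verts H\<close>, a left inverse on vertices is
  automatically two-sided. Keeping \<open>e\<close> arbitrary lets composites with
  \<open>prod.swap\<close> serve as inverses later.\<close>

lemma iso_map_inverse:
  assumes "iso_map f G H" "\<And>u. u \<in> verts G \<Longrightarrow> e (f u) = u"
  shows "iso_map e H G" "\<And>v. v \<in> verts H \<Longrightarrow> f (e v) = v"
proof -
  have img: "f ` verts G = verts H"
    using assms(1) by (auto simp: iso_map_def bij_betw_def)
  show fe: "f (e v) = v" if "v \<in> verts H" for v
    using that assms(2) unfolding img[symmetric] by auto
  have ein: "e v \<in> verts G" if "v \<in> verts H" for v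
    using that assms(2) unfolding img[symmetric] by auto
  have "bij_betw e (verts H) (verts G)"
    by (rule bij_betw_byWitness[where f' = f]) (use fe ein assms(2) iso_map_in[OF assms(1)] in auto)
  moreover have "adj H u v \<longleftrightarrow> adj G (e u) (e v)" if "u \<in> verts H" "v \<in> verts H" for u v
    using iso_map_adj[OF assms(1) ein[OF that(1)] ein[OF that(2)]] fe that by simp
  ultimately show "iso_map e H G"
    by (simp add: iso_map_def)
qed

lemma iso_map_inv_into:
  assumes "iso_map f G H"
  obtains e where "iso_map e H G" "\<And>u. u \<in> verts G \<Longrightarrow> e (f u) = u"
    "\<And>v. v \<in> verts H \<Longrightarrow> f (e v) = v"
proof -
  have "inv_into (verts G) f (f u) = u" if "u \<in> verts G" for u
    using assms that by (auto simp: iso_map_def bij_betw_def inv_into_f_f)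
  from iso_map_inverse[OF assms this] this that show ?thesis
    by blast
qed

lemma iso_map_swap: "iso_map prod.swap (G \<box> H) (H \<box> G)"
  unfolding iso_map_def
  by (auto simp: adj_cart_prod bij_betw_def)

section \<open>Isomorphism as an equivalence; products up to isomorphism\<close>

lemma graph_iso_refl: "graph_iso G G"
  unfolding graph_iso_def by (intro exI[of _ id]) auto

lemma graph_iso_sym: "graph_iso G H \<Longrightarrow> graph_iso H G"
  unfolding graph_iso_iff_iso_map by (metis iso_map_inv_into)

lemma graph_iso_trans [trans]: "graph_iso G H \<Longrightarrow> graph_iso H K \<Longrightarrow> graph_iso G K"
  unfolding graph_iso_iff_iso_map by (metis iso_map_comp)

lemma graph_iso_card: "graph_iso G H \<Longrightarrow> card (verts G) = card (verts H)"
  by (auto simp: graph_iso_def bij_betw_same_card)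

lemma cart_prod_comm: "graph_iso (G \<box> H) (H \<box> G)"
  using iso_map_swap by (auto simp: graph_iso_iff_iso_map)

lemma cart_prod_assoc: "graph_iso ((G \<box> H) \<box> K) (G \<box> (H \<box> K))"
  unfolding graph_iso_def
proof (intro exI conjI ballI)
  show "bij_betw (\<lambda>((a, b), c). (a, b, c)) (verts ((G \<box> H) \<box> K)) (verts (G \<box> (H \<box> K)))"
    by (rule bij_betw_byWitness[where f' = "\<lambda>(a, b, c). ((a, b), c)"]) auto
qed (auto simp: adj_cart_prod)

lemma cart_prod_cong:
  assumes "graph_iso G G'" "graph_iso H H'"
  shows "graph_iso (G \<box> H) (G' \<box> H')"
proof -
  from assms obtain f g where f: "iso_map f G G'" and g: "iso_map g H H'"
    by (auto simp: graph_iso_iff_iso_map)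
  have inj: "f u = f v \<longleftrightarrow> u = v" if "u \<in> verts G" "v \<in> verts G" for u v
    using f that by (auto simp: iso_map_def bij_betw_def inj_on_eq_iff)
  have inj': "g u = g v \<longleftrightarrow> u = v" if "u \<in> verts H" "v \<in> verts H" for u v
    using g that by (auto simp: iso_map_def bij_betw_def inj_on_eq_iff)
  have "bij_betw (map_prod f g) (verts G \<times> verts H) (verts G' \<times> verts H')"
    using f g by (intro bij_betw_map_prod) (auto simp: iso_map_def)
  moreover have "adj (G \<box> H) u v \<longleftrightarrow> adj (G' \<box> H') (map_prod f g u) (map_prod f g v)"
    if "u \<in> verts G \<times> verts H" "v \<in> verts G \<times> verts H" for u v
    using that by (auto simp: adj_cart_prod iso_map_adj[OF f] iso_map_adj[OF g]
      iso_map_in[OF f] iso_map_in[OF g] inj inj')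
  ultimately show ?thesis
    unfolding graph_iso_def by (intro exI[of _ "map_prod f g"]) simp
qed

text \<open>A well-formed graph has no loops, so a single vertex carries no edge; every edge of the
  product then moves the first coordinate and \<open>fst\<close> is an isomorphism.\<close>

lemma cart_prod_trivial_right:
  assumes "card (verts H) = 1" "wf_graph H"
  shows "graph_iso (G \<box> H) G"
proof -
  from assms obtain h where h: "verts H = {h}"
    by (auto simp: card_1_singleton_iff)
  then have [simp]: "\<not> adj H u v" for u v
    using wf_adjD[OF assms(2)] by fastforce
  show ?thesis
    unfolding graph_iso_def
    by (intro exI[of _ fst]) (auto simp: h adj_cart_prod bij_betw_def inj_on_def)
qed

lemma cart_prod_trivial_left:
  assumes "card (verts H) = 1" "wf_graph H"
  shows "graph_iso (H \<box> G) G"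
  using cart_prod_comm cart_prod_trivial_right[OF assms] by (rule graph_iso_trans)

section \<open>Distances\<close>

lemma walk_in_verts:
  assumes "wf_graph G" "(adj G ^^ n) u v"
  shows "u \<in> verts G \<longleftrightarrow> v \<in> verts G"
  using assms(2) by (induction n arbitrary: v) (use wf_adjD[OF assms(1)] in auto)

text \<open>Each edge of the product moves exactly one coordinate, so the steps of a walk sort into
  \<open>i\<close> steps in \<open>G\<close> and \<open>j\<close> steps in \<open>H\<close>.\<close>

lemma walk_cart_prod_D:
  assumes "(adj (G \<box> H) ^^ n) (a, b) (c, d)"
  shows "\<exists>i j. n = i + j \<and> (adj G ^^ i) a c \<and> (adj H ^^ j) b d"
  using assms
proof (induction n arbitrary: c d)
  case (Suc n)
  then obtain c' d' where 1: "(adj (G \<box> H) ^^ n) (a, b) (c', d')" "adj (G \<box> H) (c', d') (c, d)"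
    by auto
  from Suc.IH[OF 1(1)] obtain i j
    where ij: "n = i + j" "(adj G ^^ i) a c'" "(adj H ^^ j) b d'"
    by auto
  from 1(2) consider "adj G c' c" "d' = d" | "c' = c" "adj H d' d"
    by (auto simp: adj_cart_prod)
  then show ?case
  proof cases
    case 1
    with ij show ?thesis by (intro exI[of _ "Suc i"] exI[of _ j]) auto
  next
    case 2
    with ij show ?thesis by (intro exI[of _ i] exI[of _ "Suc j"]) auto
  qed
qed auto

lemma walk_cart_prod_I:
  assumes "wf_graph G" "wf_graph H" "(adj G ^^ i) a c" "(adj H ^^ j) b d"
    "a \<in> verts G" "b \<in> verts H"
  shows "(adj (G \<box> H) ^^ (i + j)) (a, b) (c, d)"
proof -
  \<comment> \<open>The walk first moves along \<open>G\<close> at height \<open>b\<close>, then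
    along \<open>H\<close> over \<open>c\<close>.\<close>
  have "(adj (G \<box> H) ^^ i) (a, b) (c, b)"
    using assms(3)
  proof (induction i arbitrary: c)
    case (Suc i)
    then obtain w where w: "(adj G ^^ i) a w" "adj G w c"
      by auto
    then have "adj (G \<box> H) (w, b) (c, b)"
      using assms(6) by (simp add: adj_cart_prod)
    with Suc.IH[OF w(1)] show ?case
      by (rule relpowp_Suc_I)
  qed auto
  moreover have "c \<in> verts G"
    using walk_in_verts assms by metis
  then have "(adj (G \<box> H) ^^ j) (c, b) (c, d)"
    using assms(4)
  proof (induction j arbitrary: d)
    case (Suc j)
    then obtain w where w: "(adj H ^^ j) b w" "adj H w d"
      by auto
    then have "adj (G \<box> H) (c, w) (c, d)"
      using Suc.prems(1) by (simp add: adj_cart_prod)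
    with Suc.IH[OF Suc.prems(1) w(1)] show ?case
      by (rule relpowp_Suc_I)
  qed auto
  ultimately show ?thesis
    by (rule relpowp_trans)
qed

lemma connected_cart_prod:
  assumes "wf_graph G" "wf_graph H" "connected_graph G" "connected_graph H"
  shows "connected_graph (G \<box> H)"
proof -
  have "(adj (G \<box> H))\<^sup>*\<^sup>* (a, b) (c, d)"
    if "a \<in> verts G" "c \<in> verts G" "b \<in> verts H" "d \<in> verts H" for a b c d
  proof -
    have "(adj G)\<^sup>*\<^sup>* a c" "(adj H)\<^sup>*\<^sup>* b d"
      using assms that by (auto simp: connected_graph_def)
    then obtain i j where "(adj G ^^ i) a c" "(adj H ^^ j) b d"
      by (auto dest!: rtranclp_imp_relpowp)
    from walk_cart_prod_I[OF assms(1,2) this that(1,3)] show ?thesis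
      by (rule relpowp_imp_rtranclp)
  qed
  then show ?thesis
    using assms(3,4) by (auto simp: connected_graph_def)
qed

text \<open>Least walk length is the usual graph distance, since a shortest walk repeats no vertex.
  The value is meaningful only when some walk exists, whence the connectedness assumptions
  below.\<close>

definition gdist :: "'a sgraph \<Rightarrow> 'a \<Rightarrow> 'a \<Rightarrow> nat" where
  "gdist G u v = (LEAST n. (adj G ^^ n) u v)"

lemma gdist_le: "(adj G ^^ n) u v \<Longrightarrow> gdist G u v \<le> n"
  unfolding gdist_def by (rule Least_le)

lemma gdist_walk:
  assumes "connected_graph G" "u \<in> verts G" "v \<in> verts G"
  shows "(adj G ^^ gdist G u v) u v"
proof -
  have "(adj G)\<^sup>*\<^sup>* u v"
    using assms by (simp add: connected_graph_def)
  then have "\<exists>n. (adj G ^^ n) u v"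
    by (rule rtranclp_imp_relpowp)
  then show ?thesis
    unfolding gdist_def by (rule LeastI_ex)
qed

lemma gdist_refl [simp]: "gdist G u u = 0"
  using gdist_le[of 0 G u u] by simp

lemma gdist_eq_0:
  assumes "connected_graph G" "u \<in> verts G" "v \<in> verts G" "gdist G u v = 0"
  shows "u = v"
  using gdist_walk[OF assms(1-3)] assms(4) by simp

text \<open>Geodesics of the factors concatenate to a walk in the product, and a geodesic of the
  product splits into walks in the factors; the two give the two inequalities.\<close>

lemma gdist_cart_prod:
  assumes "wf_graph G" "wf_graph H" "connected_graph G" "connected_graph H"
    and "a \<in> verts G" "c \<in> verts G" "b \<in> verts H" "d \<in> verts H"
  shows "gdist (G \<box> H) (a, b) (c, d) = gdist G a c + gdist H b d"
proof (rule antisym)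
  show "gdist (G \<box> H) (a, b) (c, d) \<le> gdist G a c + gdist H b d"
    using assms by (intro gdist_le walk_cart_prod_I gdist_walk)
  have "(adj (G \<box> H) ^^ gdist (G \<box> H) (a, b) (c, d)) (a, b) (c, d)"
    using assms by (intro gdist_walk connected_cart_prod) auto
  from walk_cart_prod_D[OF this]
  show "gdist G a c + gdist H b d \<le> gdist (G \<box> H) (a, b) (c, d)"
    by (auto intro!: add_mono gdist_le)
qed

lemma iso_map_walk:
  assumes "wf_graph G" "iso_map f G H" "(adj G ^^ n) u v" "u \<in> verts G"
  shows "(adj H ^^ n) (f u) (f v)"
  using assms(3)
proof (induction n arbitrary: v)
  case (Suc n)
  then obtain w where w: "(adj G ^^ n) u w" "adj G w v"
    by auto
  have "adj H (f w) (f v)"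
    using wf_adjD[OF assms(1) w(2)] iso_map_adj[OF assms(2)] w(2) by simp
  with Suc.IH[OF w(1)] show ?case
    by (rule relpowp_Suc_I)
qed auto

lemma gdist_iso_map:
  assumes "wf_graph G" "wf_graph H" "connected_graph G" "connected_graph H" "iso_map f G H"
    and "u \<in> verts G" "v \<in> verts G"
  shows "gdist H (f u) (f v) = gdist G u v"
proof (rule antisym)
  show "gdist H (f u) (f v) \<le> gdist G u v"
    by (intro gdist_le iso_map_walk[OF assms(1,5) gdist_walk[OF assms(3,6,7)] assms(6)])
  from assms(5) obtain e where e: "iso_map e H G" "\<And>u. u \<in> verts G \<Longrightarrow> e (f u) = u"
    by (rule iso_map_inv_into) blast
  have "(adj G ^^ gdist H (f u) (f v)) (e (f u)) (e (f v))"
    by (intro iso_map_walk[OF assms(2) e(1) gdist_walk[OF assms(4)]] iso_map_in[OF assms(5)] assms(6,7))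
  then show "gdist G u v \<le> gdist H (f u) (f v)"
    using e assms by (intro gdist_le) auto
qed

section \<open>Common refinement of two factorizations\<close>

definition induced :: "'a sgraph \<Rightarrow> 'a set \<Rightarrow> 'a sgraph" where
  "induced G S = Graph S {e \<in> edges G. e \<subseteq> S}"

lemma verts_induced [simp]: "verts (induced G S) = S"
  by (simp add: induced_def)

lemma adj_induced: "adj (induced G S) u v \<longleftrightarrow> adj G u v \<and> u \<in> S \<and> v \<in> S"
  by (auto simp: induced_def adj_def)

lemma wf_induced:
  assumes "wf_graph G" "S \<subseteq> verts G"
  shows "wf_graph (induced G S)"
  unfolding wf_graph_def
proof (intro conjI ballI)
  show "finite (verts (induced G S))"
    using assms by (auto simp: wf_graph_def intro: finite_subset)
  fix e assume "e \<in> edges (induced G S)"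
  then show "\<exists>u v. e = {u, v} \<and> u \<noteq> v \<and> u \<in> verts (induced G S) \<and> v \<in> verts (induced G S)"
    using assms(1) by (auto simp: wf_graph_def induced_def dest!: bspec)
qed

text \<open>The inverse \<open>e\<close> is a parameter so that the setting is symmetric: exchanging
  the two products, or the factors on either side, gives another instance. Facts are proved for one
  kind of layer and read off for the others.\<close>

locale product_iso =
  fixes G :: "'a sgraph" and H :: "'b sgraph" and G' :: "'c sgraph" and H' :: "'d sgraph"
    and f :: "'a \<times> 'b \<Rightarrow> 'c \<times> 'd" and e :: "'c \<times> 'd \<Rightarrow> 'a \<times> 'b"
  assumes wf: "wf_graph G" "wf_graph H" "wf_graph G'" "wf_graph H'"
    and conn: "connected_graph G" "connected_graph H" "connected_graph G'" "connected_graph H'"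
    and iso: "iso_map f (G \<box> H) (G' \<box> H')"
    and inverse_left: "\<And>u. u \<in> verts G \<times> verts H \<Longrightarrow> e (f u) = u"
begin

lemma iso': "iso_map e (G' \<box> H') (G \<box> H)"
  and inverse_right: "v \<in> verts G' \<times> verts H' \<Longrightarrow> f (e v) = v"
  using iso_map_inverse[OF iso] inverse_left by auto

lemma converse: "product_iso G' H' G H e f"
  by unfold_locales (use wf conn iso' inverse_right in auto)

lemma swap_domain: "product_iso H G G' H' (f \<circ> prod.swap) (prod.swap \<circ> e)"
proof unfold_locales
  show "iso_map (f \<circ> prod.swap) (H \<box> G) (G' \<box> H')"
    using iso_map_swap iso by (rule iso_map_comp)
qed (use wf conn inverse_left in auto)

lemma swap_codomain: "product_iso G H H' G' (prod.swap \<circ> f) (e \<circ> prod.swap)"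
proof unfold_locales
  show "iso_map (prod.swap \<circ> f) (G \<box> H) (H' \<box> G')"
    using iso iso_map_swap by (rule iso_map_comp)
qed (use wf conn inverse_left in auto)

section \<open>Images of layers are boxes\<close>

abbreviation layer :: "'b \<Rightarrow> ('c \<times> 'd) set" where
  "layer h \<equiv> f ` (verts G \<times> {h})"

lemma layer_subset: "h \<in> verts H \<Longrightarrow> layer h \<subseteq> verts G' \<times> verts H'"
  using iso_map_in[OF iso] by (intro image_subsetI) auto

lemma in_layer:
  assumes "a \<in> verts G" "f (a, h) = (c, d)"
  shows "(c, d) \<in> layer h" "c \<in> fst ` layer h" "d \<in> snd ` layer h"
proof -
  show cd: "(c, d) \<in> layer h"
    using assms by (intro image_eqI[of _ _ "(a, h)"]) auto
  show "c \<in> fst ` layer h" "d \<in> snd ` layer h"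
    using imageI[OF cd, of fst] imageI[OF cd, of snd] by simp_all
qed

text \<open>Take two points \<open>(c, d)\<close> and \<open>(c', d')\<close> of the image. The
  corner \<open>(c, d')\<close> lies on a geodesic between them, so its preimage lies on a geodesic
  between two vertices of height \<open>h\<close>, which forces that preimage to have height
  \<open>h\<close> too.\<close>

lemma layer_box:
  assumes h: "h \<in> verts H"
  shows "layer h = fst ` layer h \<times> snd ` layer h"
proof (rule antisym)
  show "fst ` layer h \<times> snd ` layer h \<subseteq> layer h"
  proof
    fix z assume "z \<in> fst ` layer h \<times> snd ` layer h"
    then obtain a a' where a: "a \<in> verts G" "a' \<in> verts G"
      and z: "z = (fst (f (a, h)), snd (f (a', h)))"
      by auto
    obtain c d where cd: "f (a, h) = (c, d)"
      by (cases "f (a, h)")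
    obtain c' d' where cd': "f (a', h) = (c', d')"
      by (cases "f (a', h)")
    have in': "c \<in> verts G'" "d \<in> verts H'" "c' \<in> verts G'" "d' \<in> verts H'"
      using iso_map_in[OF iso, of "(a, h)"] iso_map_in[OF iso, of "(a', h)"] a h cd cd' by auto
    obtain x y where xy: "e (c, d') = (x, y)"
      by (cases "e (c, d')")
    have xyin: "x \<in> verts G" "y \<in> verts H"
      using iso_map_in[OF iso', of "(c, d')"] in' xy by auto
    have fxy: "f (x, y) = (c, d')"
      using inverse_right[of "(c, d')"] in' xy by auto
    note dist_eq = gdist_iso_map[OF wf_cart_prod[OF wf(1,2)] wf_cart_prod[OF wf(3,4)]
        connected_cart_prod[OF wf(1,2) conn(1,2)] connected_cart_prod[OF wf(3,4) conn(3,4)] iso]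
    note dG = gdist_cart_prod[OF wf(1,2) conn(1,2)]
    note dG' = gdist_cart_prod[OF wf(3,4) conn(3,4)]
    have "gdist G a x + gdist H h y = gdist H' d d'"
      using dist_eq[of "(a, h)" "(x, y)"] a h xyin in' by (simp add: cd fxy dG dG')
    moreover have "gdist G x a' + gdist H y h = gdist G' c c'"
      using dist_eq[of "(x, y)" "(a', h)"] a h xyin in' by (simp add: cd' fxy dG dG')
    moreover have "gdist G a a' = gdist G' c c' + gdist H' d d'"
      using dist_eq[of "(a, h)" "(a', h)"] a h in' by (simp add: cd cd' dG dG')
    moreover have "gdist G a a' \<le> gdist G a x + gdist G x a'"
      by (rule gdist_le, rule relpowp_trans[OF gdist_walk gdist_walk]) (use a conn xyin in auto)
    \<comment> \<open>Adding the first two equations and comparing with the third and the triangle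
      inequality leaves no room for \<open>gdist H h y + gdist H y h\<close>.\<close>
    ultimately have "gdist H h y = 0"
      by linarith
    then have "h = y"
      using gdist_eq_0[OF conn(2) h xyin(2)] by simp
    with fxy in_layer(1)[OF xyin(1)] have "(c, d') \<in> layer h"
      by blast
    then show "z \<in> layer h"
      by (simp only: z cd cd' fst_conv snd_conv)
  qed
  show "layer h \<subseteq> fst ` layer h \<times> snd ` layer h"
    by (intro subsetI, unfold mem_Times_iff, intro conjI imageI)
qed

text \<open>The map \<open>a \<mapsto> f (a, h)\<close> identifies \<open>G\<close> with the
  subgraph of \<open>G' \<box> H'\<close> induced on \<open>layer h\<close>. That set is a box, and
  a subgraph induced on a box is the product of the subgraphs induced on its sides.\<close>

lemma first_factor_iso:
  assumes h: "h \<in> verts H"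
  shows "graph_iso G (induced G' (fst ` layer h) \<box> induced H' (snd ` layer h))"
  unfolding graph_iso_def
proof (intro exI conjI ballI)
  have "inj_on (\<lambda>a. f (a, h)) (verts G)"
    using iso h by (fastforce simp: iso_map_def bij_betw_def inj_on_def)
  moreover have "(\<lambda>a. f (a, h)) ` verts G = layer h"
    by auto
  ultimately show "bij_betw (\<lambda>a. f (a, h)) (verts G)
      (verts (induced G' (fst ` layer h) \<box> induced H' (snd ` layer h)))"
    using layer_box[OF h] by (simp add: bij_betw_def)
  fix u v assume uv: "u \<in> verts G" "v \<in> verts G"
  obtain c d where cd: "f (u, h) = (c, d)"
    by (cases "f (u, h)")
  obtain c' d' where cd': "f (v, h) = (c', d')"
    by (cases "f (v, h)")
  note proj = in_layer[OF uv(1) cd] in_layer[OF uv(2) cd']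
  have "c \<in> verts G'" "d \<in> verts H'"
    using iso_map_in[OF iso, of "(u, h)"] uv h cd by auto
  moreover have "adj G u v \<longleftrightarrow> adj (G \<box> H) (u, h) (v, h)"
    using h wf_adjD(3)[OF wf(2)] by (auto simp: adj_cart_prod)
  moreover have "\<dots> \<longleftrightarrow> adj (G' \<box> H') (c, d) (c', d')"
    using iso_map_adj[OF iso, of "(u, h)" "(v, h)"] uv h cd cd' by simp
  ultimately show "adj G u v \<longleftrightarrow>
      adj (induced G' (fst ` layer h) \<box> induced H' (snd ` layer h)) (f (u, h)) (f (v, h))"
    using proj unfolding cd cd' adj_cart_prod adj_induced verts_induced by blast
qed

text \<open>Both graphs are copies of the intersection of the \<open>G\<close>-layer and the \<open>G'\<close>-layer through
  the common base vertex.\<close>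
lemma layer_meet_iso:
  assumes g: "g \<in> verts G" and h: "h \<in> verts H" and f_gh: "f (g, h) = (g', h')"
  shows "graph_iso (induced G' (fst ` layer h)) (induced G (fst ` e ` (verts G' \<times> {h'})))"
proof -
  interpret inv: product_iso G' H' G H e f
    by (rule converse)
  have g': "g' \<in> verts G'" and h': "h' \<in> verts H'"
    using iso_map_in[OF iso, of "(g, h)"] g h f_gh by auto
  have e_gh: "e (g', h') = (g, h)"
    using inverse_left[of "(g, h)"] g h f_gh by simp
  have h'_snd: "h' \<in> snd ` layer h"
    by (rule in_layer(3)[OF g f_gh])
  have h_snd: "h \<in> snd ` inv.layer h'"
    by (rule inv.in_layer(3)[OF g' e_gh])
  have fst_sub: "fst ` X \<subseteq> Y" if "X \<subseteq> Y \<times> Z" for X :: "('x \<times> 'y) set" and Y Z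
    using that by auto
  have subs: "fst ` layer h \<subseteq> verts G'" "fst ` inv.layer h' \<subseteq> verts G"
    using fst_sub[OF layer_subset[OF h]] fst_sub[OF inv.layer_subset[OF h']] by auto
  \<comment> \<open>Both \<open>x\<close> and \<open>h'\<close> lie in the projections of
    \<open>layer h\<close>, so the box property puts \<open>(x, h')\<close> into
    \<open>layer h\<close>; hence \<open>e\<close> sends it to height \<open>h\<close>. The fact
    \<open>fro\<close> is the mirror image.\<close>
  have to: "\<exists>y \<in> fst ` inv.layer h'. e (x, h') = (y, h)" if x: "x \<in> fst ` layer h" for x
  proof -
    have "(x, h') \<in> layer h"
      using x h'_snd by (subst layer_box[OF h]) (rule SigmaI)
    then obtain y where y: "y \<in> verts G" "f (y, h) = (x, h')"
      by (elim imageE SigmaE) simp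
    then have "e (x, h') = (y, h)"
      using inverse_left[of "(y, h)"] h by simp
    moreover have "x \<in> verts G'"
      using subs(1) x by blast
    ultimately show ?thesis
      using inv.in_layer(2) by blast
  qed
  have fro: "\<exists>x \<in> fst ` layer h. f (y, h) = (x, h')" if y: "y \<in> fst ` inv.layer h'" for y
  proof -
    have "(y, h) \<in> inv.layer h'"
      using y h_snd by (subst inv.layer_box[OF h']) (rule SigmaI)
    then obtain x where x: "x \<in> verts G'" "e (x, h') = (y, h)"
      by (elim imageE SigmaE) simp
    then have "f (y, h) = (x, h')"
      using inverse_right[of "(x, h')"] h' by simp
    moreover have "y \<in> verts G"
      using subs(2) y by blast
    ultimately show ?thesis
      using in_layer(2) by blast
  qed
  have "bij_betw (\<lambda>x. fst (e (x, h'))) (fst ` layer h) (fst ` inv.layer h')"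
  proof (rule bij_betw_byWitness[where f' = "\<lambda>y. fst (f (y, h))"])
    show "\<forall>x\<in>fst ` layer h. fst (f (fst (e (x, h')), h)) = x"
    proof
      fix x assume x: "x \<in> fst ` layer h"
      from to[OF x] obtain y where "e (x, h') = (y, h)" by auto
      moreover have "f (e (x, h')) = (x, h')"
        using inverse_right subsetD[OF subs(1) x] h' by simp
      ultimately show "fst (f (fst (e (x, h')), h)) = x" by simp
    qed
    show "\<forall>y\<in>fst ` inv.layer h'. fst (e (fst (f (y, h)), h')) = y"
    proof
      fix y assume y: "y \<in> fst ` inv.layer h'"
      from fro[OF y] obtain x where "f (y, h) = (x, h')" by auto
      moreover have "e (f (y, h)) = (y, h)"
        using inverse_left subsetD[OF subs(2) y] h by simp
      ultimately show "fst (e (fst (f (y, h)), h')) = y" by simp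
    qed
    show "(\<lambda>x. fst (e (x, h'))) ` fst ` layer h \<subseteq> fst ` inv.layer h'"
    proof (rule image_subsetI)
      fix x assume "x \<in> fst ` layer h"
      from to[OF this] show "fst (e (x, h')) \<in> fst ` inv.layer h'"
        by (elim bexE) (simp only: fst_conv)
    qed
    show "(\<lambda>y. fst (f (y, h))) ` fst ` inv.layer h' \<subseteq> fst ` layer h"
    proof (rule image_subsetI)
      fix y assume "y \<in> fst ` inv.layer h'"
      from fro[OF this] show "fst (f (y, h)) \<in> fst ` layer h"
        by (elim bexE) (simp only: fst_conv)
    qed
  qed
  moreover have "adj (induced G' (fst ` layer h)) u v \<longleftrightarrow>
      adj (induced G (fst ` inv.layer h')) (fst (e (u, h'))) (fst (e (v, h')))"
    if u: "u \<in> fst ` layer h" and v: "v \<in> fst ` layer h" for u v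
  proof -
    from to[OF u] obtain y where y: "y \<in> fst ` inv.layer h'" "e (u, h') = (y, h)" by auto
    from to[OF v] obtain z where z: "z \<in> fst ` inv.layer h'" "e (v, h') = (z, h)" by auto
    \<comment> \<open>At a constant height adjacency in the product is adjacency in the first
      factor, because the second factor has no loops.\<close>
    have "adj G' u v \<longleftrightarrow> adj (G' \<box> H') (u, h') (v, h')"
      using h' wf_adjD(3)[OF wf(4)] by (auto simp: adj_cart_prod)
    also have "\<dots> \<longleftrightarrow> adj (G \<box> H) (y, h) (z, h)"
      using iso_map_adj[OF iso', of "(u, h')" "(v, h')"] subsetD[OF subs(1) u]
        subsetD[OF subs(1) v] h' y(2) z(2) by simp
    also have "\<dots> \<longleftrightarrow> adj G y z"
      using h wf_adjD(3)[OF wf(2)] by (auto simp: adj_cart_prod)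
    finally show ?thesis
      unfolding adj_induced y(2) z(2) fst_conv using u v y(1) z(1) by blast
  qed
  ultimately show ?thesis
    unfolding graph_iso_def by (intro exI[of _ "\<lambda>x. fst (e (x, h'))"]) simp
qed

end

text \<open>The four pieces come from the layers through one base vertex. Projecting the images of
  the \<open>G\<close>- and \<open>H\<close>-layers splits \<open>G\<close> and \<open>H\<close>;
  projecting the preimages of the \<open>G'\<close>- and \<open>H'\<close>-layers splits
  \<open>G'\<close> and \<open>H'\<close>. The pieces of the two splittings agree in pairs by
  \<open>layer_meet_iso\<close>.\<close>

theorem cart_prod_refinement:
  fixes G :: "'a sgraph" and H :: "'b sgraph" and G' :: "'c sgraph" and H' :: "'d sgraph"
  assumes wf: "wf_graph G" "wf_graph H" "wf_graph G'" "wf_graph H'"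
    and conn: "connected_graph G" "connected_graph H" "connected_graph G'" "connected_graph H'"
    and iso: "graph_iso (G \<box> H) (G' \<box> H')"
  obtains A C :: "'c sgraph" and B D :: "'d sgraph"
  where "wf_graph A" "wf_graph B" "wf_graph C" "wf_graph D"
    "graph_iso G (A \<box> B)" "graph_iso H (C \<box> D)"
    "graph_iso G' (A \<box> C)" "graph_iso H' (B \<box> D)"
proof -
  from iso obtain f where f: "iso_map f (G \<box> H) (G' \<box> H')"
    by (auto simp: graph_iso_iff_iso_map)
  then obtain e where e: "\<And>u. u \<in> verts (G \<box> H) \<Longrightarrow> e (f u) = u"
    by (rule iso_map_inv_into) blast
  interpret product_iso G H G' H' f e
    by unfold_locales (use wf conn f e in auto)
  obtain g h where g: "g \<in> verts G" and h: "h \<in> verts H"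
    using conn by (auto simp: connected_graph_def)
  obtain g' h' where gh': "f (g, h) = (g', h')"
    by (cases "f (g, h)")
  have g': "g' \<in> verts G'" and h': "h' \<in> verts H'"
    using iso_map_in[OF f, of "(g, h)"] g h gh' by auto
  \<comment> \<open>Swapping coordinates on the domain, the codomain or both turns each statement
    about first factors into the one about the other factors.\<close>
  interpret sd: product_iso H G G' H' "f \<circ> prod.swap" "prod.swap \<circ> e"
    by (rule swap_domain)
  interpret sc: product_iso G H H' G' "prod.swap \<circ> f" "e \<circ> prod.swap"
    by (rule swap_codomain)
  interpret sdc: product_iso H G H' G' "prod.swap \<circ> (f \<circ> prod.swap)" "(prod.swap \<circ> e) \<circ> prod.swap"
    by (rule sd.swap_codomain)
  interpret inv: product_iso G' H' G H e f
    by (rule converse)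
  interpret inv_sd: product_iso H' G' G H "e \<circ> prod.swap" "prod.swap \<circ> f"
    by (rule inv.swap_domain)
  have swap_image: "prod.swap ` (X \<times> Y) = Y \<times> X" for X :: "'x set" and Y :: "'y set"
    by auto
  have fst_swap: "fst ` prod.swap ` X = snd ` X" for X :: "('x \<times> 'y) set"
    by (auto simp: image_image)
  \<comment> \<open>Unprimed pieces lie in \<open>G'\<close> and \<open>H'\<close> and are cut out
    by layers through \<open>(g, h)\<close>; primed pieces lie in \<open>G\<close> and
    \<open>H\<close> and are cut out by layers through \<open>(g', h')\<close>.\<close>
  define A where "A = induced G' (fst ` layer h)"
  define B where "B = induced H' (snd ` layer h)"
  define C where "C = induced G' (fst ` f ` ({g} \<times> verts H))"
  define D where "D = induced H' (snd ` f ` ({g} \<times> verts H))"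
  define A' where "A' = induced G (fst ` e ` (verts G' \<times> {h'}))"
  define B' where "B' = induced G (fst ` e ` ({g'} \<times> verts H'))"
  define C' where "C' = induced H (snd ` e ` (verts G' \<times> {h'}))"
  define D' where "D' = induced H (snd ` e ` ({g'} \<times> verts H'))"
  note folds = A_def[symmetric] B_def[symmetric] C_def[symmetric] D_def[symmetric]
    A'_def[symmetric] B'_def[symmetric] C'_def[symmetric] D'_def[symmetric]
  note unswap = image_comp[symmetric] swap_image fst_swap
  have 1: "graph_iso G (A \<box> B)"
    using first_factor_iso[OF h] by (simp only: folds)
  have 2: "graph_iso H (C \<box> D)"
    using sd.first_factor_iso[OF g] by (simp only: unswap folds)
  have 3: "graph_iso G' (A' \<box> C')"
    using inv.first_factor_iso[OF h'] by (simp only: folds)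
  have 4: "graph_iso H' (B' \<box> D')"
    using inv_sd.first_factor_iso[OF g'] by (simp only: unswap folds)
  have A: "graph_iso A A'"
    using layer_meet_iso[OF g h gh'] by (simp only: folds)
  have C: "graph_iso C C'"
    using sd.layer_meet_iso[OF h g, of g' h'] gh' by (simp only: unswap folds) simp
  have B: "graph_iso B B'"
    using sc.layer_meet_iso[OF g h, of h' g'] gh' by (simp only: unswap folds) simp
  have D: "graph_iso D D'"
    using sdc.layer_meet_iso[OF h g, of h' g'] gh' by (simp only: unswap folds) simp
  have sub: "f ` ({g} \<times> verts H) \<subseteq> verts G' \<times> verts H'"
    using iso_map_in[OF f] g by (intro image_subsetI) auto
  have proj_sub: "fst ` X \<subseteq> verts G'" "snd ` X \<subseteq> verts H'" if "X \<subseteq> verts G' \<times> verts H'" for X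
    using that by auto
  show ?thesis
  proof (rule that[of A B C D])
    show "graph_iso G' (A \<box> C)"
      using 3 graph_iso_sym[OF cart_prod_cong[OF A C]] by (rule graph_iso_trans)
    show "graph_iso H' (B \<box> D)"
      using 4 graph_iso_sym[OF cart_prod_cong[OF B D]] by (rule graph_iso_trans)
    show "wf_graph A" "wf_graph B" "wf_graph C" "wf_graph D"
      unfolding A_def B_def C_def D_def
      by (intro wf_induced wf proj_sub layer_subset h sub)+
  qed (use 1 2 in auto)
qed

section \<open>Prime factors\<close>

text \<open>\<open>cart_factor\<close> admits cofactors only on the vertex type of the graph itself,
  while a cofactor such as \<open>Q \<box> B\<close> lives on pairs. The set \<open>S\<close>
  guarantees enough elements to relabel it.\<close>

lemma copy_into_type:
  fixes X :: "'b sgraph" and S :: "'a set"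
  assumes "wf_graph X" "finite S" "card (verts X) \<le> card S"
  obtains Y :: "'a sgraph" where "wf_graph Y" "graph_iso X Y"
proof -
  obtain f where f: "f ` verts X \<subseteq> S" "inj_on f (verts X)"
    using card_le_inj[OF _ assms(2,3)] assms(1) by (auto simp: wf_graph_def)
  define Y where "Y = Graph (f ` verts X) ((\<lambda>e. f ` e) ` edges X)"
  have sub: "e \<subseteq> verts X" if "e \<in> edges X" for e
    using assms(1) that by (auto simp: wf_graph_def dest!: bspec)
  have "wf_graph Y"
    unfolding wf_graph_def
  proof (intro conjI ballI)
    show "finite (verts Y)"
      using assms(1) by (simp add: Y_def wf_graph_def)
    fix e assume "e \<in> edges Y"
    then obtain e' where e': "e = f ` e'" "e' \<in> edges X"
      by (auto simp: Y_def)
    then obtain u v where uv: "e' = {u, v}" "u \<noteq> v" "u \<in> verts X" "v \<in> verts X"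
      using assms(1) by (auto simp: wf_graph_def dest!: bspec)
    then show "\<exists>u v. e = {u, v} \<and> u \<noteq> v \<and> u \<in> verts Y \<and> v \<in> verts Y"
      using f(2) e' by (intro exI[of _ "f u"] exI[of _ "f v"]) (auto simp: Y_def inj_on_eq_iff)
  qed
  moreover have "graph_iso X Y"
    unfolding graph_iso_def
  proof (intro exI conjI ballI)
    show "bij_betw f (verts X) (verts Y)"
      using f by (simp add: Y_def bij_betw_def)
    fix u v assume uv: "u \<in> verts X" "v \<in> verts X"
    have "{f u, f v} \<in> (\<lambda>e. f ` e) ` edges X \<longleftrightarrow> {u, v} \<in> edges X"
    proof
      assume "{f u, f v} \<in> (\<lambda>e. f ` e) ` edges X"
      then obtain e where e: "e \<in> edges X" "f ` {u, v} = f ` e"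
        by auto
      then have "{u, v} = e"
        using inj_on_image_eq_iff[OF f(2)] sub uv by (metis empty_subsetI insert_subset)
      with e show "{u, v} \<in> edges X" by simp
    next
      assume "{u, v} \<in> edges X"
      from imageI[OF this, of "\<lambda>e. f ` e"] show "{f u, f v} \<in> (\<lambda>e. f ` e) ` edges X"
        by simp
    qed
    then show "adj X u v \<longleftrightarrow> adj Y (f u) (f v)"
      by (simp add: adj_def Y_def)
  qed
  ultimately show ?thesis
    by (rule that)
qed

lemma cart_factor_trans:
  fixes P A B G :: "'a sgraph"
  assumes "cart_factor P A" "graph_iso G (A \<box> B)" "wf_graph B" "wf_graph G"
    "finite (verts P)" "verts P \<noteq> {}"
  shows "cart_factor P G"
proof -
  from assms(1) obtain Q :: "'a sgraph" where Q: "wf_graph Q" "graph_iso A (P \<box> Q)"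
    by (auto simp: cart_factor_def)
  have "graph_iso G ((P \<box> Q) \<box> B)"
    using assms(2) cart_prod_cong[OF Q(2) graph_iso_refl] by (rule graph_iso_trans)
  then have iso: "graph_iso G (P \<box> (Q \<box> B))"
    using cart_prod_assoc by (rule graph_iso_trans)
  \<comment> \<open>As \<open>P\<close> is nonempty, the cofactor \<open>Q \<box> B\<close> has at
    most as many vertices as \<open>G\<close>, so \<open>verts G\<close> has room for a copy of
    it.\<close>
  have "card (verts G) = card (verts P) * card (verts (Q \<box> B))"
    using graph_iso_card[OF iso] by (simp add: card_cartesian_product)
  moreover have "card (verts P) \<ge> 1"
    using assms(5,6) by (simp add: Suc_leI card_gt_0_iff)
  ultimately have "card (verts (Q \<box> B)) \<le> card (verts G)"
    by simp
  with copy_into_type[OF wf_cart_prod[OF Q(1) assms(3)], of "verts G"] assms(4)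
  obtain Y :: "'a sgraph" where Y: "wf_graph Y" "graph_iso (Q \<box> B) Y"
    by (auto simp: wf_graph_def)
  have "graph_iso G (P \<box> Y)"
    using iso cart_prod_cong[OF graph_iso_refl Y(2)] by (rule graph_iso_trans)
  with Y(1) show ?thesis
    by (auto simp: cart_factor_def)
qed

text \<open>Induction on the order: a graph that is not prime splits into two nontrivial factors,
  the first of which is strictly smaller, and its prime factors are inherited.\<close>

lemma prime_factor_exists:
  fixes G :: "'a sgraph"
  assumes "wf_graph G" "card (verts G) \<ge> 2"
  shows "\<exists>P :: 'a sgraph. wf_graph P \<and> cart_prime P \<and> cart_factor P G"
  using assms
proof (induction "card (verts G)" arbitrary: G rule: less_induct)
  case (less G)
  show ?case
  proof (cases "cart_prime G")
    case True
    \<comment> \<open>A one-vertex cofactor makes a prime graph a factor of itself.\<close>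
    define T :: "'a sgraph" where "T = Graph {undefined} {}"
    have T: "wf_graph T" "card (verts T) = 1"
      by (auto simp: T_def wf_graph_def)
    have "cart_factor G G"
      using T graph_iso_sym[OF cart_prod_trivial_right[OF T(2,1)]] by (auto simp: cart_factor_def)
    with True less.prems show ?thesis
      by blast
  next
    case False
    then obtain G1 G2 :: "'a sgraph" where G12: "wf_graph G1" "wf_graph G2"
      "card (verts G1) \<ge> 2" "card (verts G2) \<ge> 2" "graph_iso G (G1 \<box> G2)"
      using less.prems by (auto simp: cart_prime_def)
    have "card (verts G) = card (verts G1) * card (verts G2)"
      using graph_iso_card[OF G12(5)] by (simp add: card_cartesian_product)
    then have "card (verts G1) < card (verts G)"
      using G12 by simp
    from less.hyps[OF this G12(1,3)] obtain P :: "'a sgraph"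
      where P: "wf_graph P" "cart_prime P" "cart_factor P G1"
      by blast
    have "finite (verts P)" "verts P \<noteq> {}"
      using P by (auto simp: wf_graph_def cart_prime_def)
    with cart_factor_trans[OF P(3) G12(5,2) less.prems(1)] P show ?thesis
      by blast
  qed
qed

lemma cart_prime_factor_trivial:
  fixes G A B :: "'a sgraph"
  assumes "cart_prime G" "graph_iso G (A \<box> B)" "wf_graph A" "wf_graph B"
  shows "card (verts A) = 1 \<or> card (verts B) = 1"
proof -
  have "card (verts A) * card (verts B) = card (verts G)"
    using graph_iso_card[OF assms(2)] by (simp add: card_cartesian_product)
  moreover have "card (verts G) \<ge> 2"
    using assms(1) by (simp add: cart_prime_def)
  \<comment> \<open>Primality only forbids two factors of order at least 2, so empty factors are
    excluded separately through the order of \<open>G\<close>.\<close>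
  ultimately have "card (verts A) \<noteq> 0" "card (verts B) \<noteq> 0"
    by (metis mult_is_0 not_numeral_le_zero)+
  moreover have "\<not> (card (verts A) \<ge> 2 \<and> card (verts B) \<ge> 2)"
    using assms by (auto simp: cart_prime_def)
  ultimately show ?thesis
    by linarith
qed

section \<open>Spectra of Kronecker sums\<close>

text \<open>The Kronecker product, with an index \<open>i\<close> encoding the pair
  \<open>(i div m, i mod m)\<close> for a second factor of size \<open>m\<close>. The encoding
  orders pairs lexicographically, which later preserves triangularity.\<close>

definition kron :: "'a :: semiring_1 mat \<Rightarrow> 'a mat \<Rightarrow> 'a mat" where
  "kron A B = mat (dim_row A * dim_row B) (dim_col A * dim_col B)
     (\<lambda>(i, j). A $$ (i div dim_row B, j div dim_col B) * B $$ (i mod dim_row B, j mod dim_col B))"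

lemma kron_carrier:
  "A \<in> carrier_mat n n \<Longrightarrow> B \<in> carrier_mat m m \<Longrightarrow> kron A B \<in> carrier_mat (n * m) (n * m)"
  by (auto simp: kron_def)

lemma index_kron:
  assumes "A \<in> carrier_mat n n" "B \<in> carrier_mat m m" "i < n * m" "j < n * m"
  shows "kron A B $$ (i, j) = A $$ (i div m, j div m) * B $$ (i mod m, j mod m)"
  using assms by (auto simp: kron_def)

lemma div_mod_less:
  fixes i :: nat
  assumes "i < n * m"
  shows "i div m < n" "i mod m < m"
  using assms by (simp add: less_mult_imp_div_less, metis mod_less_divisor mult_0_right not_gr_zero not_less_zero)

lemma bij_betw_div_mod:
  fixes n m :: nat
  shows "bij_betw (\<lambda>i. (i div m, i mod m)) {0..<n * m} ({0..<n} \<times> {0..<m})"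
proof (rule bij_betw_byWitness[where f' = "\<lambda>(a, b). a * m + b"])
  show "(\<lambda>(a, b). a * m + b) ` ({0..<n} \<times> {0..<m}) \<subseteq> {0..<n * m}"
  proof clarsimp
    fix a b assume ab: "a < n" "b < m"
    then have "a * m + b < Suc a * m" by simp
    also have "\<dots> \<le> n * m" using ab by (intro mult_le_mono1) simp
    finally show "a * m + b < n * m" .
  qed
qed (auto simp: div_mod_less)

text \<open>The mixed-product rule: decoding the summation index into a pair turns the sum into a
  product of two independent sums.\<close>

lemma kron_mult:
  fixes A B C D :: "'a :: comm_semiring_1 mat"
  assumes "A \<in> carrier_mat n n" "B \<in> carrier_mat n n" "C \<in> carrier_mat m m" "D \<in> carrier_mat m m"
  shows "kron A C * kron B D = kron (A * B) (C * D)"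
proof (rule eq_matI)
  note carr = kron_carrier[OF assms(1,3)] kron_carrier[OF assms(2,4)]
    kron_carrier[OF mult_carrier_mat[OF assms(1,2)] mult_carrier_mat[OF assms(3,4)]]
  show "dim_row (kron A C * kron B D) = dim_row (kron (A * B) (C * D))"
    "dim_col (kron A C * kron B D) = dim_col (kron (A * B) (C * D))"
    using carr by auto
  fix i j
  assume "i < dim_row (kron (A * B) (C * D))" "j < dim_col (kron (A * B) (C * D))"
  then have ij: "i < n * m" "j < n * m"
    using carr by auto
  note dm = div_mod_less[OF ij(1)] div_mod_less[OF ij(2)]
  have "(kron A C * kron B D) $$ (i, j) = (\<Sum>l = 0..<n * m. kron A C $$ (i, l) * kron B D $$ (l, j))"
    using carr ij by (auto simp: scalar_prod_def intro!: sum.cong)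
  also have "\<dots> = (\<Sum>l = 0..<n * m. (\<lambda>(x, y). (A $$ (i div m, x) * B $$ (x, j div m)) *
      (C $$ (i mod m, y) * D $$ (y, j mod m))) (l div m, l mod m))"
    using index_kron[OF assms(1,3) ij(1)] index_kron[OF assms(2,4) _ ij(2)]
    by (intro sum.cong) (simp_all add: mult.assoc mult.left_commute)
  also have "\<dots> = (\<Sum>(x, y) \<in> {0..<n} \<times> {0..<m}. (A $$ (i div m, x) * B $$ (x, j div m)) *
      (C $$ (i mod m, y) * D $$ (y, j mod m)))"
    by (rule sum.reindex_bij_betw[OF bij_betw_div_mod])
  also have "\<dots> = (\<Sum>x = 0..<n. A $$ (i div m, x) * B $$ (x, j div m)) *
      (\<Sum>y = 0..<m. C $$ (i mod m, y) * D $$ (y, j mod m))"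
    by (simp add: sum_product sum.cartesian_product)
  also have "\<dots> = (A * B) $$ (i div m, j div m) * (C * D) $$ (i mod m, j mod m)"
    using assms dm by (auto simp: scalar_prod_def)
  also have "\<dots> = kron (A * B) (C * D) $$ (i, j)"
    using assms ij by (subst index_kron[of _ n _ m]) auto
  finally show "(kron A C * kron B D) $$ (i, j) = kron (A * B) (C * D) $$ (i, j)" .
qed

lemma div_mod_eq_iff: "i div m = j div m \<and> i mod m = j mod m \<longleftrightarrow> i = j" for i j m :: nat
  by (metis div_mult_mod_eq)

lemma kron_one: "kron (1\<^sub>m n) (1\<^sub>m m) = (1\<^sub>m (n * m) :: 'a :: semiring_1 mat)"
proof (rule eq_matI)
  fix i j
  assume "i < dim_row (1\<^sub>m (n * m) :: 'a mat)" "j < dim_col (1\<^sub>m (n * m) :: 'a mat)"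
  then have ij: "i < n * m" "j < n * m"
    by auto
  show "kron (1\<^sub>m n) (1\<^sub>m m) $$ (i, j) = (1\<^sub>m (n * m) :: 'a mat) $$ (i, j)"
    using div_mod_less[OF ij(1)] div_mod_less[OF ij(2)] ij div_mod_eq_iff[of i m j]
    by (subst index_kron[of _ n _ m]) auto
qed (auto simp: kron_def)

text \<open>The Kronecker sum of square matrices; on graph matrices it describes the Cartesian
  product.\<close>

definition kron_sum :: "'a :: semiring_1 mat \<Rightarrow> 'a mat \<Rightarrow> 'a mat" where
  "kron_sum A B = kron A (1\<^sub>m (dim_row B)) + kron (1\<^sub>m (dim_row A)) B"

lemma kron_sum_carrier:
  "A \<in> carrier_mat n n \<Longrightarrow> B \<in> carrier_mat m m \<Longrightarrow> kron_sum A B \<in> carrier_mat (n * m) (n * m)"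
  by (auto simp: kron_sum_def intro!: add_carrier_mat kron_carrier)

lemma index_kron_sum:
  fixes A :: "'a :: semiring_1 mat"
  assumes "A \<in> carrier_mat n n" "B \<in> carrier_mat m m" "i < n * m" "j < n * m"
  shows "kron_sum A B $$ (i, j) =
    (if i mod m = j mod m then A $$ (i div m, j div m) else 0) +
    (if i div m = j div m then B $$ (i mod m, j mod m) else 0)"
proof -
  have "kron_sum A B $$ (i, j) = kron A (1\<^sub>m m) $$ (i, j) + kron (1\<^sub>m n) B $$ (i, j)"
    using assms kron_carrier[OF assms(1) one_carrier_mat, of m] kron_carrier[OF one_carrier_mat assms(2), of n]
    by (auto simp: kron_sum_def)
  then show ?thesis
    using assms div_mod_less[OF assms(3)] div_mod_less[OF assms(4)]
    by (auto simp: index_kron[of _ n _ m])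
qed

text \<open>\<open>kron P R\<close> and \<open>kron Q U\<close> conjugate both summands at once: by
  the mixed-product rule the identity factors become \<open>P * Q\<close> and \<open>R * U\<close>,
  which are again identities.\<close>

lemma similar_kron_sum:
  fixes A B S T :: "'a :: comm_ring_1 mat"
  assumes A: "A \<in> carrier_mat n n" and B: "B \<in> carrier_mat m m"
    and AS: "similar_mat_wit A S P Q" and BT: "similar_mat_wit B T R U"
  shows "similar_mat (kron_sum A B) (kron_sum S T)"
proof -
  note a = similar_mat_witD2[OF A AS] and b = similar_mat_witD2[OF B BT]
  have dims: "dim_row A = n" "dim_row B = m" "dim_row S = n" "dim_row T = m"
    using A B a b by auto
  note carr = kron_carrier[of _ n _ m] mult_carrier_mat[of _ "n * m" "n * m" _ "n * m"]
  have eq: "kron P R * kron_sum S T * kron Q U = kron_sum A B"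
  proof -
    have "kron P R * kron_sum S T * kron Q U =
        kron P R * kron S (1\<^sub>m m) * kron Q U + kron P R * kron (1\<^sub>m n) T * kron Q U"
      unfolding kron_sum_def dims
      by (subst mult_add_distrib_mat[of _ "n * m" "n * m" _ "n * m"],
          (use a b in \<open>auto intro!: carr\<close>)[3],
          subst add_mult_distrib_mat[of _ "n * m" "n * m" _ _ "n * m"])
         (use a b in \<open>auto intro!: carr\<close>)
    also have "kron P R * kron S (1\<^sub>m m) * kron Q U = kron (P * S * Q) (R * 1\<^sub>m m * U)"
      using a b by (simp add: kron_mult[of _ n _ _ m])
    also have "kron P R * kron (1\<^sub>m n) T * kron Q U = kron (P * 1\<^sub>m n * Q) (R * T * U)"
      using a b by (simp add: kron_mult[of _ n _ _ m])
    finally show ?thesis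
      using a b by (simp add: kron_sum_def dims)
  qed
  have "similar_mat_wit (kron_sum A B) (kron_sum S T) (kron P R) (kron Q U)"
    by (rule similar_mat_witI[of _ _ "n * m"])
       (use a b eq in \<open>auto simp: kron_mult[of _ n _ _ m] kron_one intro!: kron_carrier kron_sum_carrier\<close>)
  then show ?thesis
    by (auto simp: similar_mat_def)
qed

text \<open>If \<open>j < i\<close>, then lexicographically either the quotient of \<open>j\<close>
  is smaller, or the quotients agree and the remainder is smaller. Either way each nominally present
  entry of \<open>S\<close> or \<open>T\<close> lies strictly below the diagonal.\<close>

lemma upper_triangular_kron_sum:
  fixes S T :: "'a :: semiring_1 mat"
  assumes S: "S \<in> carrier_mat n n" "upper_triangular S"
    and T: "T \<in> carrier_mat m m" "upper_triangular T"
  shows "upper_triangular (kron_sum S T)"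
proof
  fix i j assume ji: "j < i" "i < dim_row (kron_sum S T)"
  then have ij: "i < n * m" "j < n * m"
    using kron_sum_carrier[OF S(1) T(1)] by auto
  have S0: "S $$ (a, b) = 0" if "b < a" "a < n" for a b
    using that S by auto
  have T0: "T $$ (a, b) = 0" if "b < a" "a < m" for a b
    using that T by auto
  have "j div m \<le> i div m"
    using ji by (simp add: div_le_mono)
  moreover have "j div m = i div m \<Longrightarrow> j mod m < i mod m"
    using ji(1) by (metis div_mult_mod_eq nat_add_left_cancel_less)
  moreover have "j mod m = i mod m \<Longrightarrow> j div m \<noteq> i div m"
    using ji(1) by (metis div_mult_mod_eq nat_neq_iff)
  ultimately show "kron_sum S T $$ (i, j) = 0"
    unfolding index_kron_sum[OF S(1) T(1) ij]
    using div_mod_less[OF ij(1)] by (auto intro!: S0 T0)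
qed

text \<open>Schur decomposition realizes \<open>as\<close> and \<open>bs\<close> as diagonals in the
  given order, so the diagonal of the triangular matrix \<open>kron_sum S T\<close> can be read off
  entry by entry.\<close>

lemma char_poly_kron_sum:
  fixes A B :: "complex mat"
  assumes A: "A \<in> carrier_mat n n" and B: "B \<in> carrier_mat m m"
    and as: "char_poly A = (\<Prod>a\<leftarrow>as. [:- a, 1:])" and bs: "char_poly B = (\<Prod>b\<leftarrow>bs. [:- b, 1:])"
  shows "char_poly (kron_sum A B) =
    (\<Prod>l\<leftarrow>[0..<n * m]. [:- (as ! (l div m) + bs ! (l mod m)), 1:])"
proof -
  obtain S P Q where "schur_decomposition A as = (S, P, Q)"
    by (cases "schur_decomposition A as")
  from schur_decomposition[OF A as this]
  have S: "similar_mat_wit A S P Q" "upper_triangular S" "diag_mat S = as"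
    by auto
  obtain T R U where "schur_decomposition B bs = (T, R, U)"
    by (cases "schur_decomposition B bs")
  from schur_decomposition[OF B bs this]
  have T: "similar_mat_wit B T R U" "upper_triangular T" "diag_mat T = bs"
    by auto
  have Sc: "S \<in> carrier_mat n n" and Tc: "T \<in> carrier_mat m m"
    using similar_mat_witD2[OF A S(1)] similar_mat_witD2[OF B T(1)] by auto
  have S_diag: "S $$ (i, i) = as ! i" if "i < n" for i
    using S(3) that Sc by (auto simp: diag_mat_def)
  have T_diag: "T $$ (i, i) = bs ! i" if "i < m" for i
    using T(3) that Tc by (auto simp: diag_mat_def)
  have "char_poly (kron_sum A B) = char_poly (kron_sum S T)"
    by (rule char_poly_similar[OF similar_kron_sum[OF A B S(1) T(1)]])
  also have "\<dots> = (\<Prod>a\<leftarrow>diag_mat (kron_sum S T). [:- a, 1:])"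
    by (rule char_poly_upper_triangular[OF kron_sum_carrier[OF Sc Tc]
          upper_triangular_kron_sum[OF Sc S(2) Tc T(2)]])
  also have "diag_mat (kron_sum S T) = map (\<lambda>l. as ! (l div m) + bs ! (l mod m)) [0..<n * m]"
    unfolding diag_mat_def
    using kron_sum_carrier[OF Sc Tc]
    by (auto simp: index_kron_sum[OF Sc Tc] div_mod_less S_diag T_diag)
  finally show ?thesis
    by (simp add: comp_def)
qed

lemma char_poly_kron_sum_cong:
  fixes A B A' B' :: "complex mat"
  assumes carr: "A \<in> carrier_mat n n" "B \<in> carrier_mat m m"
      "A' \<in> carrier_mat n' n'" "B' \<in> carrier_mat m' m'"
    and eq: "char_poly A = char_poly A'" "char_poly B = char_poly B'"
  shows "char_poly (kron_sum A B) = char_poly (kron_sum A' B')"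
proof -
  \<comment> \<open>The sizes are the degrees of the characteristic polynomials. The same root lists
    then serve both pairs of matrices.\<close>
  have "n = n'" "m = m'"
    using degree_monic_char_poly carr eq by metis+
  moreover obtain as bs where "char_poly A = (\<Prod>a\<leftarrow>as. [:- a, 1:])" "char_poly B = (\<Prod>b\<leftarrow>bs. [:- b, 1:])"
    using char_poly_factorized[OF carr(1)] char_poly_factorized[OF carr(2)] by blast
  ultimately show ?thesis
    using char_poly_kron_sum[OF carr(1,2), of as bs] char_poly_kron_sum[OF carr(3,4), of as bs] eq
    by simp
qed

section \<open>Spectra of Cartesian products\<close>

text \<open>Conjugation by \<open>e\<close> is a sign-preserving bijection from the permutations of
  \<open>S\<close> to those of \<open>T\<close>, and it matches the Leibniz terms.\<close>

lemma charpoly_on_reindex: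
  assumes e: "bij_betw e S T" and fin: "finite S"
  shows "charpoly_on T M = charpoly_on S (\<lambda>i j. M (e i) (e j))"
proof -
  have inj: "inj_on e S" and img: "e ` S = T"
    using e by (auto simp: bij_betw_def)
  have "bij_betw (map_permutation S e) {p. p permutes S} {p. p permutes T}"
  proof (rule bij_betw_byWitness[where f' = "map_permutation T (inv_into S e)"])
    show "\<forall>p\<in>{p. p permutes S}. map_permutation T (inv_into S e) (map_permutation S e p) = p"
      using map_permutation_compose_inv[OF e] inj by (auto simp: inv_into_f_f)
    show "\<forall>p\<in>{p. p permutes T}. map_permutation S e (map_permutation T (inv_into S e) p) = p"
      using map_permutation_compose_inv[OF bij_betw_inv_into[OF e]] img by (auto simp: f_inv_into_f)
    show "map_permutation S e ` {p. p permutes S} \<subseteq> {p. p permutes T}"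
      using map_permutation_permutes[OF e] by auto
    show "map_permutation T (inv_into S e) ` {p. p permutes T} \<subseteq> {p. p permutes S}"
      using map_permutation_permutes[OF bij_betw_inv_into[OF e]] by auto
  qed
  from sum.reindex_bij_betw[OF this, symmetric]
  have "charpoly_on T M = (\<Sum>p | p permutes S. of_int (sign (map_permutation S e p)) *
      (\<Prod>v\<in>T. (if map_permutation S e p v = v then [:0, 1:] else 0) - [:M v (map_permutation S e p v):]))"
    by (simp add: charpoly_on_def)
  also have "\<dots> = charpoly_on S (\<lambda>i j. M (e i) (e j))"
    unfolding charpoly_on_def
  proof (intro sum.cong refl, elim CollectE)
    fix p assume p: "p permutes S"
    have "(\<Prod>v\<in>T. (if map_permutation S e p v = v then [:0, 1:] else 0) - [:M v (map_permutation S e p v):])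
      = (\<Prod>v\<in>S. (if map_permutation S e p (e v) = e v then [:0, 1:] else 0) -
          [:M (e v) (map_permutation S e p (e v)):])"
      by (rule prod.reindex_bij_betw[OF e, symmetric])
    also have "\<dots> = (\<Prod>v\<in>S. (if p v = v then [:0, 1:] else 0) - [:M (e v) (e (p v)):])"
      using inj p
      by (intro prod.cong) (auto simp: map_permutation_apply inj_on_eq_iff permutes_in_image)
    finally show "of_int (sign (map_permutation S e p)) *
        (\<Prod>v\<in>T. (if map_permutation S e p v = v then [:0, 1:] else 0) - [:M v (map_permutation S e p v):])
      = of_int (sign p) * (\<Prod>v\<in>S. (if p v = v then [:0, 1:] else 0) - [:M (e v) (e (p v)):])"
      by (simp add: sign_map_permutation[OF inj p fin])
  qed
  finally show ?thesis .
qed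

lemma charpoly_on_cong:
  assumes "\<And>i j. i \<in> S \<Longrightarrow> j \<in> S \<Longrightarrow> M i j = N i j"
  shows "charpoly_on S M = charpoly_on S N"
  unfolding charpoly_on_def
  by (intro sum.cong arg_cong2[of _ _ _ _ "(*)"] prod.cong)
     (auto simp: assms permutes_in_image)

text \<open>The bridge from the set-indexed Leibniz sum to matrices indexed by numbers, where
  similarity and Schur decomposition apply.\<close>

lemma charpoly_on_char_poly:
  "charpoly_on {0..<n} M = char_poly (mat n n (\<lambda>(i, j). M i j))"
proof -
  have "char_poly (mat n n (\<lambda>(i, j). M i j)) = (\<Sum>p | p permutes {0..<n}. signof p *
      (\<Prod>i = 0..<n. char_poly_matrix (mat n n (\<lambda>(i, j). M i j)) $$ (i, p i)))"
    unfolding char_poly_def by (intro det_def' char_poly_matrix_closed) auto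
  also have "\<dots> = charpoly_on {0..<n} M"
    unfolding charpoly_on_def
  proof (intro sum.cong refl, elim CollectE)
    fix p assume p: "p permutes {0..<n}"
    have "p i < n" if "i < n" for i
      using permutes_in_image[OF p, of i] that by auto
    then show "signof p * (\<Prod>i = 0..<n. char_poly_matrix (mat n n (\<lambda>(i, j). M i j)) $$ (i, p i)) =
        of_int (sign p) * (\<Prod>v\<in>{0..<n}. (if p v = v then [:0, 1:] else 0) - [:M v (p v):])"
      by (intro arg_cong2[of _ _ _ _ "(*)"] prod.cong refl) (auto simp: char_poly_matrix_def)
  qed
  finally show ?thesis ..
qed

lemma charpoly_on_enum:
  assumes "bij_betw e {0..<n} S"
  shows "charpoly_on S M = char_poly (mat n n (\<lambda>(i, j). M (e i) (e j)))"
  by (simp add: charpoly_on_reindex[OF assms] charpoly_on_char_poly)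

lemma charpoly_on_kron_sum:
  assumes e: "bij_betw e {0..<n} S" and f: "bij_betw f {0..<m} T"
  shows "charpoly_on (S \<times> T) (\<lambda>u v. (if snd u = snd v then M (fst u) (fst v) else 0) +
      (if fst u = fst v then N (snd u) (snd v) else 0)) =
    char_poly (kron_sum (mat n n (\<lambda>(i, j). M (e i) (e j))) (mat m m (\<lambda>(i, j). N (f i) (f j))))"
    (is "charpoly_on _ ?K = char_poly (kron_sum ?A ?B)")
proof -
  \<comment> \<open>Enumerating \<open>S \<times> T\<close> through the index encoding of
    \<open>kron\<close> makes the two matrices equal entrywise, not merely similar.\<close>
  have bij: "bij_betw (map_prod e f \<circ> (\<lambda>i. (i div m, i mod m))) {0..<n * m} (S \<times> T)"
    by (rule bij_betw_trans[OF bij_betw_div_mod bij_betw_map_prod[OF e f]])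
  have inj: "e i = e j \<longleftrightarrow> i = j" if "i < n" "j < n" for i j
    using e that by (auto simp: bij_betw_def inj_on_eq_iff)
  have inj': "f i = f j \<longleftrightarrow> i = j" if "i < m" "j < m" for i j
    using f that by (auto simp: bij_betw_def inj_on_eq_iff)
  have "mat (n * m) (n * m) (\<lambda>(i, j). ?K ((map_prod e f \<circ> (\<lambda>i. (i div m, i mod m))) i)
      ((map_prod e f \<circ> (\<lambda>i. (i div m, i mod m))) j)) = kron_sum ?A ?B" (is "?L = _")
  proof (rule eq_matI)
    show "dim_row ?L = dim_row (kron_sum ?A ?B)" "dim_col ?L = dim_col (kron_sum ?A ?B)"
      using kron_sum_carrier[of ?A n ?B m] by auto
    fix i j assume "i < dim_row (kron_sum ?A ?B)" "j < dim_col (kron_sum ?A ?B)"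
    then have ij: "i < n * m" "j < n * m"
      using kron_sum_carrier[of ?A n ?B m] by auto
    show "?L $$ (i, j) = kron_sum ?A ?B $$ (i, j)"
      using ij by (subst index_kron_sum[of _ n _ m]) (auto simp: div_mod_less inj inj')
  qed
  then show ?thesis
    using charpoly_on_enum[OF bij, of ?K] by simp
qed

text \<open>Off the diagonal at most one summand can be nonzero, as an edge moves one coordinate. On
  the diagonal both conditions hold: adjacency gives 0 for lack of loops, and the Laplacian gives
  the sum of the degrees.\<close>

lemma graph_matrix_cart_prod:
  assumes wf: "wf_graph G" "wf_graph H"
    and u: "u \<in> verts (G \<box> H)" and v: "v \<in> verts (G \<box> H)"
  shows "graph_matrix k (G \<box> H) u v = (if snd u = snd v then graph_matrix k G (fst u) (fst v) else 0) +
    (if fst u = fst v then graph_matrix k H (snd u) (snd v) else 0)"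
proof -
  obtain a b c d where uv: "u = (a, b)" "v = (c, d)"
    by (cases u, cases v)
  have mem: "a \<in> verts G" "b \<in> verts H" "c \<in> verts G" "d \<in> verts H"
    using u v uv by auto
  have irr: "\<not> adj G x x" "\<not> adj H y y" for x y
    using wf_adjD(3) wf by metis+
  have adj: "adj_matrix (G \<box> H) u v = (if b = d then adj_matrix G a c else 0) +
      (if a = c then adj_matrix H b d else 0)"
    using irr mem by (auto simp: adj_matrix_def uv adj_cart_prod)
  \<comment> \<open>The neighbours in the two directions form disjoint copies of the neighbourhoods
    in the factors, so degrees add.\<close>
  have "{x \<in> verts (G \<box> H). adj (G \<box> H) (c, d) x} =
      (\<lambda>x. (x, d)) ` {x \<in> verts G. adj G c x} \<union> (\<lambda>y. (c, y)) ` {y \<in> verts H. adj H d y}"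
    using mem by (auto simp: adj_cart_prod)
  moreover have "finite {x \<in> verts G. adj G c x}" "finite {y \<in> verts H. adj H d y}"
    using wf by (auto simp: wf_graph_def)
  moreover have "(\<lambda>x. (x, d)) ` {x \<in> verts G. adj G c x} \<inter> (\<lambda>y. (c, y)) ` {y \<in> verts H. adj H d y} = {}"
    using irr by auto
  ultimately have deg: "Defs.degree (G \<box> H) v = Defs.degree G c + Defs.degree H d"
    by (simp add: Defs.degree_def uv card_Un_disjoint card_image inj_on_def)
  show ?thesis
  proof (cases k)
    case Adjacency
    then show ?thesis
      using adj by (simp add: graph_matrix_def uv)
  next
    case Laplacian
    then show ?thesis
      using adj deg irr by (auto simp: graph_matrix_def lap_matrix_def uv adj_matrix_def)
  qed
qed

text \<open>Lets spectra be traded for polynomials: a characteristic polynomial is monic and splits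
  over the complex numbers, so its root multiset determines it.\<close>

lemma charpoly_on_factorized:
  assumes "finite S"
  shows "charpoly_on S M = (\<Prod>a\<in>#proots (charpoly_on S M). [:- a, 1:])"
    and "size (proots (charpoly_on S M)) = card S"
proof -
  obtain e where "bij_betw e {0..<card S} S"
    using ex_bij_betw_nat_finite[OF assms] by blast
  note eq = charpoly_on_enum[OF this, of M]
  define A where "A = mat (card S) (card S) (\<lambda>(i, j). M (e i) (e j))"
  have A: "A \<in> carrier_mat (card S) (card S)"
    by (simp add: A_def)
  from char_poly_factorized[OF A] obtain as
    where as: "char_poly A = (\<Prod>a\<leftarrow>as. [:- a, 1:])" "length as = card S"
    by blast
  have "proots (\<Prod>a\<leftarrow>as. [:- a, 1:]) = mset as" for as :: "complex list"
  proof (induction as)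
    case (Cons a as)
    have "(\<Prod>a\<leftarrow>as. [:- a, 1:]) \<noteq> 0"
      by (auto simp: prod_list_zero_iff)
    then show ?case
      using Cons.IH proots_mult[of "[:- a, 1:]" "\<Prod>a\<leftarrow>as. [:- a, 1:]"]
      by (simp del: mult_pCons_left)
  qed simp
  with as have "proots (char_poly A) = mset as"
    by simp
  with as eq show "charpoly_on S M = (\<Prod>a\<in>#proots (charpoly_on S M). [:- a, 1:])"
    "size (proots (charpoly_on S M)) = card S"
    by (simp_all add: A_def flip: prod_mset_prod_list)
qed

section \<open>Cospectrality of products and of isomorphic graphs\<close>

lemma spectrum_eq_imp_charpoly_eq:
  assumes "wf_graph G" "wf_graph G'" "spectrum k G = spectrum k G'"
  shows "charpoly_on (verts G) (graph_matrix k G) = charpoly_on (verts G') (graph_matrix k G')"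
  using charpoly_on_factorized(1)[of "verts G" "graph_matrix k G"]
    charpoly_on_factorized(1)[of "verts G'" "graph_matrix k G'"] assms
  by (simp add: wf_graph_def spectrum_def)

lemma size_spectrum: "wf_graph G \<Longrightarrow> size (spectrum k G) = card (verts G)"
  by (simp add: wf_graph_def spectrum_def charpoly_on_factorized(2))

lemma spectrum_cart_prod_cong:
  assumes wf: "wf_graph G" "wf_graph H" "wf_graph G'" "wf_graph H'"
    and spec: "spectrum k G = spectrum k G'" "spectrum k H = spectrum k H'"
  shows "spectrum k (G \<box> H) = spectrum k (G' \<box> H')"
proof -
  have fin: "finite (verts G)" "finite (verts H)" "finite (verts G')" "finite (verts H')"
    using wf by (auto simp: wf_graph_def)
  obtain e f e' f' where bij: "bij_betw e {0..<card (verts G)} (verts G)"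
    "bij_betw f {0..<card (verts H)} (verts H)" "bij_betw e' {0..<card (verts G')} (verts G')"
    "bij_betw f' {0..<card (verts H')} (verts H')"
    using fin[THEN ex_bij_betw_nat_finite] by blast
  have prod: "charpoly_on (verts (X \<box> Y)) (graph_matrix k (X \<box> Y)) =
      charpoly_on (verts X \<times> verts Y) (\<lambda>u v. (if snd u = snd v then graph_matrix k X (fst u) (fst v) else 0) +
      (if fst u = fst v then graph_matrix k Y (snd u) (snd v) else 0))"
    if "wf_graph X" "wf_graph Y" for X :: "'x sgraph" and Y :: "'y sgraph"
    unfolding verts_cart_prod
    by (rule charpoly_on_cong, rule graph_matrix_cart_prod[OF that]) auto
  \<comment> \<open>Both spectra become root multisets of Kronecker sums. Folding the enumerated
    factor matrices back into \<open>charpoly_on\<close> reduces the claim to equal polynomials of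
    the factors.\<close>
  show ?thesis
    unfolding spectrum_def prod[OF wf(1,2)] prod[OF wf(3,4)]
      charpoly_on_kron_sum[OF bij(1,2)] charpoly_on_kron_sum[OF bij(3,4)]
    by (rule arg_cong[of _ _ proots], rule char_poly_kron_sum_cong,
        (rule mat_carrier)+, unfold bij[THEN charpoly_on_enum, symmetric])
       (use wf spec in \<open>auto intro: spectrum_eq_imp_charpoly_eq\<close>)
qed

text \<open>An isomorphism relabels rows and columns simultaneously and preserves degrees. This is
  what excludes an isomorphism between members of the two families.\<close>

lemma spectrum_graph_iso:
  assumes "wf_graph G" "graph_iso G H"
  shows "spectrum k G = spectrum k H"
proof -
  from assms(2) obtain f where f: "iso_map f G H"
    by (auto simp: graph_iso_iff_iso_map)
  then have bij: "bij_betw f (verts G) (verts H)"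
    by (simp add: iso_map_def)
  have fin: "finite (verts G)"
    using assms(1) by (simp add: wf_graph_def)
  have adj: "adj_matrix H (f u) (f v) = adj_matrix G u v" if "u \<in> verts G" "v \<in> verts G" for u v
    using iso_map_adj[OF f that] by (simp add: adj_matrix_def)
  have deg: "Defs.degree H (f v) = Defs.degree G v" if v: "v \<in> verts G" for v
  proof -
    have "{u \<in> verts H. adj H (f v) u} = f ` {u \<in> verts G. adj G v u}"
    proof -
      have "verts H = f ` verts G"
        using bij by (simp add: bij_betw_def)
      with v iso_map_adj[OF f v] show ?thesis
        by auto
    qed
    moreover have "inj_on f {u \<in> verts G. adj G v u}"
      using bij by (auto simp: bij_betw_def intro: inj_on_subset)
    ultimately show ?thesis
      by (simp add: Defs.degree_def card_image)
  qed
  have "f u = f v \<longleftrightarrow> u = v" if "u \<in> verts G" "v \<in> verts G" for u v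
    using bij that by (auto simp: bij_betw_def inj_on_eq_iff)
  then have "graph_matrix k H (f u) (f v) = graph_matrix k G u v"
    if "u \<in> verts G" "v \<in> verts G" for u v
    using that adj deg by (cases k) (auto simp: graph_matrix_def lap_matrix_def)
  then have "charpoly_on (verts H) (graph_matrix k H) = charpoly_on (verts G) (graph_matrix k G)"
    unfolding charpoly_on_reindex[OF bij fin] by (rule charpoly_on_cong)
  then show ?thesis
    by (simp add: spectrum_def)
qed

section \<open>Non-isomorphic products\<close>

text \<open>Once \<open>B\<close> and \<open>C\<close> are single vertices, \<open>G\<close> and
  \<open>G'\<close> are both copies of \<open>A\<close>, while \<open>H\<close> and
  \<open>H'\<close> are both copies of \<open>D\<close>.\<close>

lemma refinement_trivial_imp_iso:
  fixes G H G' H' A B C D :: "'a sgraph"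
  assumes "graph_iso G (A \<box> B)" "graph_iso H (C \<box> D)" "graph_iso G' (A \<box> C)" "graph_iso H' (B \<box> D)"
    and "wf_graph B" "wf_graph C" "card (verts B) = 1" "card (verts C) = 1"
  shows "graph_iso G G'" "graph_iso H H'"
proof -
  note A = graph_iso_trans[OF assms(1) cart_prod_trivial_right[OF assms(7,5)]]
    graph_iso_trans[OF assms(3) cart_prod_trivial_right[OF assms(8,6)]]
  show "graph_iso G G'"
    by (rule graph_iso_trans[OF A(1) graph_iso_sym[OF A(2)]])
  note D = graph_iso_trans[OF assms(2) cart_prod_trivial_left[OF assms(8,6)]]
    graph_iso_trans[OF assms(4) cart_prod_trivial_left[OF assms(7,5)]]
  show "graph_iso H H'"
    by (rule graph_iso_trans[OF D(1) graph_iso_sym[OF D(2)]])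
qed

text \<open>The piece \<open>B\<close> is shared by \<open>G\<close> and \<open>H'\<close>, and
  \<open>C\<close> by \<open>H\<close> and \<open>G'\<close>. The third alternative therefore has to
  cover these crosswise pairs too.\<close>

lemma graph_iso_factors:
  fixes G H G' H' :: "'a sgraph"
  assumes wf: "wf_graph G" "wf_graph H" "wf_graph G'" "wf_graph H'"
    and conn: "connected_graph G" "connected_graph H" "connected_graph G'" "connected_graph H'"
    and spec: "spectrum k G = spectrum k G'" "spectrum k H = spectrum k H'"
      "spectrum k G \<noteq> spectrum k H"
    and cond: "cart_prime G \<and> cart_prime H \<and> cart_prime G' \<and> cart_prime H'
      \<or> coprime (card (verts G)) (card (verts H))
      \<or> \<not> (\<exists>P. wf_graph P \<and> cart_prime P \<and> (cart_factor P G \<or> cart_factor P G') \<and>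
            (cart_factor P H \<or> cart_factor P H'))"
    and iso: "graph_iso (G \<box> H) (G' \<box> H')"
  shows "graph_iso G G' \<and> graph_iso H H'"
proof -
  from wf conn iso obtain A B C D :: "'a sgraph"
    where wf': "wf_graph A" "wf_graph B" "wf_graph C" "wf_graph D"
      and G: "graph_iso G (A \<box> B)" and H: "graph_iso H (C \<box> D)"
      and G': "graph_iso G' (A \<box> C)" and H': "graph_iso H' (B \<box> D)"
    by (rule cart_prod_refinement)
  note refined = G H G' H'
  have card_eq: "card (verts G) = card (verts A) * card (verts B)"
    "card (verts H) = card (verts C) * card (verts D)"
    "card (verts G') = card (verts A) * card (verts C)"
    "card (verts H') = card (verts B) * card (verts D)"
    using refined[THEN graph_iso_card] by (simp_all add: card_cartesian_product)
  have "card (verts G) \<noteq> 0" "card (verts H) \<noteq> 0"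
    using wf(1,2) conn(1,2) by (auto simp: wf_graph_def connected_graph_def)
  then have pos: "card (verts A) \<noteq> 0" "card (verts B) \<noteq> 0" "card (verts C) \<noteq> 0" "card (verts D) \<noteq> 0"
    using card_eq by auto
  \<comment> \<open>Cospectral graphs have equal order; cancelling \<open>card (verts A)\<close>
    leaves \<open>B\<close> and \<open>C\<close> of equal order, so it suffices to treat
    \<open>B\<close>.\<close>
  have "card (verts G) = card (verts G')"
    using spec(1) size_spectrum wf by metis
  then have BC: "card (verts B) = card (verts C)"
    using card_eq pos by simp
  have "card (verts B) = 1 \<and> card (verts C) = 1"
    using cond
  proof (elim disjE conjE)
    assume prime: "cart_prime G" "cart_prime H" "cart_prime G'" "cart_prime H'"
    show ?thesis
    proof (rule ccontr)
      assume "\<not> ?thesis"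
      then have ne: "card (verts B) \<noteq> 1" "card (verts C) \<noteq> 1"
        using BC by auto
      \<comment> \<open>With \<open>B\<close> nontrivial, primality of \<open>G\<close> makes
        \<open>A\<close> trivial and primality of \<open>H'\<close> makes \<open>D\<close> trivial,
        so \<open>G\<close> and \<open>H'\<close> are both copies of \<open>B\<close>.\<close>
      with cart_prime_factor_trivial[OF prime(1) G wf'(1,2)]
        cart_prime_factor_trivial[OF prime(4) H' wf'(2,4)]
      have "card (verts A) = 1" "card (verts D) = 1"
        by auto
      then have GB: "graph_iso G B" and H'B: "graph_iso H' B"
        using graph_iso_trans[OF G cart_prod_trivial_left[OF _ wf'(1)]]
          graph_iso_trans[OF H' cart_prod_trivial_right[OF _ wf'(4)]] by simp_all
      have "spectrum k G = spectrum k H'"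
        by (rule spectrum_graph_iso[OF wf(1) graph_iso_trans[OF GB graph_iso_sym[OF H'B]]])
      with spec(2,3) show False
        by simp
    qed
  next
    assume "coprime (card (verts G)) (card (verts H))"
    \<comment> \<open>The order of \<open>B\<close> divides that of \<open>G\<close> directly, and
      that of \<open>H\<close> because \<open>C\<close> has the same order.\<close>
    moreover have "card (verts B) dvd card (verts G)" "card (verts B) dvd card (verts H)"
      unfolding card_eq BC by simp_all
    ultimately have "is_unit (card (verts B))"
      by (rule coprime_common_divisor)
    with BC show ?thesis
      by simp
  next
    assume none: "\<not> (\<exists>P. wf_graph P \<and> cart_prime P \<and> (cart_factor P G \<or> cart_factor P G') \<and>
            (cart_factor P H \<or> cart_factor P H'))"
    have "\<not> card (verts B) \<ge> 2"
    proof
      assume "card (verts B) \<ge> 2"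
      \<comment> \<open>A prime factor of \<open>B\<close> would be a common prime factor of
        \<open>G\<close> and \<open>H'\<close>.\<close>
      from prime_factor_exists[OF wf'(2) this] obtain P :: "'a sgraph"
        where P: "wf_graph P" "cart_prime P" "cart_factor P B"
        by blast
      have P': "finite (verts P)" "verts P \<noteq> {}"
        using P by (auto simp: wf_graph_def cart_prime_def)
      have "cart_factor P G"
        by (rule cart_factor_trans[OF P(3) graph_iso_trans[OF G cart_prod_comm] wf'(1) wf(1) P'])
      moreover have "cart_factor P H'"
        by (rule cart_factor_trans[OF P(3) H' wf'(4) wf(4) P'])
      ultimately show False
        using none P by blast
    qed
    with pos BC show ?thesis
      by linarith
  qed
  with refinement_trivial_imp_iso[OF refined wf'(2,3)] show ?thesis
    by blast
qed

section \<open>Assembling the family of products\<close>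

theorem theorem1:
  fixes k :: mat_kind and G H :: "nat \<Rightarrow> 'a sgraph" and p q :: nat
  assumes p: "p \<ge> 1" and q: "q \<ge> 1"
    and wfG: "\<forall>i<p. wf_graph (G i) \<and> connected_graph (G i)"
    and wfH: "\<forall>j<q. wf_graph (H j) \<and> connected_graph (H j)"
    and specG: "\<forall>i<p. spectrum k (G i) = spectrum k (G 0)"
    and nisoG: "\<forall>i<p. \<forall>i'<p. i \<noteq> i' \<longrightarrow> \<not> graph_iso (G i) (G i')"
    and specH: "\<forall>j<q. spectrum k (H j) = spectrum k (H 0)"
    and nisoH: "\<forall>j<q. \<forall>j'<q. j \<noteq> j' \<longrightarrow> \<not> graph_iso (H j) (H j')"
    and diff: "spectrum k (G 0) \<noteq> spectrum k (H 0)"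
    and cond: "(\<forall>i<p. cart_prime (G i)) \<and> (\<forall>j<q. cart_prime (H j))
       \<or> (\<forall>i<p. \<forall>j<q. coprime (card (verts (G i))) (card (verts (H j))))
       \<or> \<not> (\<exists>P i j. i < p \<and> j < q \<and> wf_graph P \<and> cart_prime P
              \<and> cart_factor P (G i) \<and> cart_factor P (H j))"
  shows "(\<forall>i<p. \<forall>j<q. wf_graph (G i \<box> H j) \<and> connected_graph (G i \<box> H j))
       \<and> (\<forall>i<p. \<forall>j<q. spectrum k (G i \<box> H j) = spectrum k (G 0 \<box> H 0))
       \<and> (\<forall>i<p. \<forall>j<q. \<forall>i'<p. \<forall>j'<q. (i, j) \<noteq> (i', j')
            \<longrightarrow> \<not> graph_iso (G i \<box> H j) (G i' \<box> H j'))"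
proof (intro conjI allI impI)
  fix i j assume i: "i < p" and j: "j < q"
  show "wf_graph (G i \<box> H j)" "connected_graph (G i \<box> H j)"
    using wfG wfH i j by (auto intro: wf_cart_prod connected_cart_prod)
  show "spectrum k (G i \<box> H j) = spectrum k (G 0 \<box> H 0)"
  proof (rule spectrum_cart_prod_cong)
    show "spectrum k (G i) = spectrum k (G 0)" "spectrum k (H j) = spectrum k (H 0)"
      using specG specH i j by blast+
  qed (use wfG wfH i j p q in auto)
  fix i' j' assume i': "i' < p" and j': "j' < q" and ne: "(i, j) \<noteq> (i', j')"
  show "\<not> graph_iso (G i \<box> H j) (G i' \<box> H j')"
  proof
    assume iso: "graph_iso (G i \<box> H j) (G i' \<box> H j')"
    have "graph_iso (G i) (G i') \<and> graph_iso (H j) (H j')"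
    proof (rule graph_iso_factors[OF _ _ _ _ _ _ _ _ _ _ _ _ iso])
      show "spectrum k (G i) = spectrum k (G i')" "spectrum k (H j) = spectrum k (H j')"
        "spectrum k (G i) \<noteq> spectrum k (H j)"
        using specG[rule_format, OF i] specG[rule_format, OF i'] specH[rule_format, OF j]
          specH[rule_format, OF j'] diff by simp_all
      show "cart_prime (G i) \<and> cart_prime (H j) \<and> cart_prime (G i') \<and> cart_prime (H j')
        \<or> coprime (card (verts (G i))) (card (verts (H j)))
        \<or> \<not> (\<exists>P. wf_graph P \<and> cart_prime P \<and> (cart_factor P (G i) \<or> cart_factor P (G i')) \<and>
            (cart_factor P (H j) \<or> cart_factor P (H j')))"
        using cond
      proof (elim disjE)
        assume "(\<forall>i<p. cart_prime (G i)) \<and> (\<forall>j<q. cart_prime (H j))"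
        then show ?thesis using i j i' j' by simp
      next
        assume "\<forall>i<p. \<forall>j<q. coprime (card (verts (G i))) (card (verts (H j)))"
        then show ?thesis using i j by simp
      next
        assume "\<not> (\<exists>P i j. i < p \<and> j < q \<and> wf_graph P \<and> cart_prime P
          \<and> cart_factor P (G i) \<and> cart_factor P (H j))"
        \<comment> \<open>The hypothesis ranges over all index pairs, so it also excludes common
          prime factors of \<open>G i\<close> and \<open>H j'\<close> and of \<open>G i'\<close> and
          \<open>H j\<close>.\<close>
        then show ?thesis using i j i' j' by (intro disjI2) blast
      qed
    qed (use wfG wfH i j i' j' in auto)
    \<comment> \<open>Distinct members of one family are non-isomorphic, so isomorphic factors must
      carry the same index.\<close>
    then have "i = i'" "j = j'"
      using nisoG nisoH i j i' j' by auto
    with ne show False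
      by simp
  qed
qed

end
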